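(* Let $n\in\mathbb{N}$. For every $z\in\mathbb{C}$ with $\frac12\leq\Re(z)\leq1$, $$\mathbb{E}_{\nu^{\otimes n}\otimes\nu^{\otimes n}}\circ\mathcal{A}_{n,z}=\Gamma^2\left(\frac{z+1}{2}\right)\mathcal{J}\circ\mathcal{B}_{n,z},$$ i.e. for every $h=(h_1,\dots,h_n):\Omega_n\to\mathbb{C}^n$, $$\int_{\mathbb{R}_+^n\times\mathbb{R}_+^n}(\mathcal{A}_{n,z}h)(\tau,\sigma)\,d\nu^{\otimes n}(\tau)\,d\nu^{\otimes n}(\sigma)=\Gamma\left(\frac{z+1}{2}\right)^2\mathcal{J}(\mathcal{B}_{n,z}h)$$ as functions on $\Omega_n\times\Omega_n$.
   Context: Let $[n]=\{1,\dots,n\}$ and let $\Omega_n=\{-1,1\}^n$ carry the uniform probability measure $\mu_n$. For $x\in\Omega_n$, $x^{(j)}$ is $x$ with $x_j$ replaced by $-x_j$, and $(D_jf)(x)=\frac{f(x)-f(x^{(j)})}{2}$. For $A\subseteq[n]$, $w_A(x)=\prod_{j\in A}x_j$ and $\widehat f(A)=\int f\,w_A\,d\mu_n$. $\Delta=\sum_{j=1}^nD_j$, and for $z\in\mathbb{C}$, $\Delta^zf=\sum_{\emptyset\neq A\subseteq[n]}|A|^z\widehat f(A)w_A$. For $h=(h_1,\dots,h_n):\Omega_n\to\mathbb{C}^n$ put $\mathcal{B}_{n,z}h=\Delta^{-z}\big(\sum_{j=1}^nD_jh_j\big)$. $\mathcal{J}$ maps functions on $\Omega_n$ to functions on $\Omega_n\times\Omega_n$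 by $(\mathcal{J}f)(x,y)=f(x_1y_1,\dots,x_ny_n)$. $\mathbb{R}_+=(0,\infty)$ and $\nu$ is the probability measure $d\nu=e^{-t}dt$ on $\mathbb{R}_+$. For $A\subseteq[n]$, $j\in[n]$, $V_{A,j}=\{\tau\in\mathbb{R}^n_+:\tau_i\geq\tau_j\text{ for all }i\in A\}$. For $\tau\in\mathbb{R}^n_+$, $P_j^\tau$ is the projection on $L_2(\Omega_n)$ given by $P_j^\tau w_A=\mathbf 1_A(j)\mathbf 1_{V_{A,j}}(\tau)w_A$ for $A\subseteq[n]$. The operator $\mathcal{A}_{n,z}$ is $$(\mathcal{A}_{n,z}h)(\tau,\sigma)=\sum_{j,k=1}^n\tau_j^{\frac{z-1}{2}}\sigma_k^{\frac{z-1}{2}}(P_j^\tau\otimes P_k^\sigma)(\mathcal{J}h_j),\qquad\tau,\sigma\in\mathbb{R}^n_+,$$ where $P_j^\tau\otimes P_k^\sigma$ acts on functions on $\Omega_n\times\Omega_n$ ($P_j^\tau$ in the first variable, $P_k^\sigma$ in the second). $\Gamma$ is the Gamma function. *)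

theory Defs
  imports "HOL-Probability.Probability"
begin

text \<open>
  The set \<open>[n]\<close> is \<open>{1..n}\<close>, and points indexed by it (of the cube, of \<open>\<real>\<^sub>+\<^sup>n\<close>) are extensional
  functions on \<open>{1..n}\<close>. Functions on the cube are total functions \<open>(nat \<Rightarrow> real) \<Rightarrow> complex\<close>; the
  operators below read them only on the cube, and their results are meaningful only there.
\<close>

definition cube :: "nat \<Rightarrow> (nat \<Rightarrow> real) set" where
  "cube n = {1..n} \<rightarrow>\<^sub>E {-1, 1}"

definition cube_measure :: "nat \<Rightarrow> (nat \<Rightarrow> real) measure" where
  "cube_measure n = uniform_count_measure (cube n)"

definition flip :: "nat \<Rightarrow> (nat \<Rightarrow> real) \<Rightarrow> (nat \<Rightarrow> real)" where
  "flip j x = x(j := - x j)"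

definition discrete_deriv :: "nat \<Rightarrow> ((nat \<Rightarrow> real) \<Rightarrow> complex) \<Rightarrow> (nat \<Rightarrow> real) \<Rightarrow> complex" where
  "discrete_deriv j f x = (f x - f (flip j x)) / 2"

definition walsh :: "nat set \<Rightarrow> (nat \<Rightarrow> real) \<Rightarrow> complex" where
  "walsh A x = (\<Prod>j\<in>A. complex_of_real (x j))"

definition walsh_coeff :: "nat \<Rightarrow> ((nat \<Rightarrow> real) \<Rightarrow> complex) \<Rightarrow> nat set \<Rightarrow> complex" where
  "walsh_coeff n f A = (LINT x|cube_measure n. f x * walsh A x)"

definition laplace_pow ::
    "nat \<Rightarrow> complex \<Rightarrow> ((nat \<Rightarrow> real) \<Rightarrow> complex) \<Rightarrow> (nat \<Rightarrow> real) \<Rightarrow> complex" where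
  "laplace_pow n z f x =
     (\<Sum>A | A \<noteq> {} \<and> A \<subseteq> {1..n}. of_nat (card A) powr z * walsh_coeff n f A * walsh A x)"

text \<open>A map \<open>h = (h\<^sub>1, \<dots>, h\<^sub>n)\<close> into \<open>\<complex>\<^sup>n\<close> is given by its components, \<open>h j\<close> for \<open>j \<in> {1..n}\<close>.\<close>

definition B_op ::
    "nat \<Rightarrow> complex \<Rightarrow> (nat \<Rightarrow> (nat \<Rightarrow> real) \<Rightarrow> complex) \<Rightarrow> (nat \<Rightarrow> real) \<Rightarrow> complex" where
  "B_op n z h = laplace_pow n (- z) (\<lambda>x. \<Sum>j=1..n. discrete_deriv j (h j) x)"

definition J_op ::
    "nat \<Rightarrow> ((nat \<Rightarrow> real) \<Rightarrow> complex) \<Rightarrow> (nat \<Rightarrow> real) \<times> (nat \<Rightarrow> real) \<Rightarrow> complex" where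
  "J_op n f = (\<lambda>(x, y). f (\<lambda>i\<in>{1..n}. x i * y i))"

definition exp_measure :: "real measure" where
  "exp_measure = density (restrict_space lborel {0<..}) (\<lambda>t. ennreal (exp (- t)))"

definition exp_measure_pow :: "nat \<Rightarrow> (nat \<Rightarrow> real) measure" where
  "exp_measure_pow n = Pi\<^sub>M {1..n} (\<lambda>_. exp_measure)"

definition V_set :: "nat \<Rightarrow> nat set \<Rightarrow> nat \<Rightarrow> (nat \<Rightarrow> real) set" where
  "V_set n A j = {\<tau> \<in> {1..n} \<rightarrow>\<^sub>E {0<..}. \<forall>i\<in>A. \<tau> i \<ge> \<tau> j}"

text \<open>The linear extension of the prescription on Walsh functions; see \<open>P_op_walsh\<close> below.\<close>

definition P_op ::
    "nat \<Rightarrow> nat \<Rightarrow> (nat \<Rightarrow> real) \<Rightarrow> ((nat \<Rightarrow> real) \<Rightarrow> complex) \<Rightarrow> (nat \<Rightarrow> real) \<Rightarrow> complex" where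
  "P_op n j \<tau> f x =
     (\<Sum>A\<in>Pow {1..n}. indicator A j * indicator (V_set n A j) \<tau> * walsh_coeff n f A * walsh A x)"

text \<open>The operator \<open>S \<otimes> T\<close> on functions of two variables: \<open>T\<close> in the second, \<open>S\<close> in the first.\<close>

definition tensor_op ::
    "(('a \<Rightarrow> complex) \<Rightarrow> 'a \<Rightarrow> complex) \<Rightarrow> (('b \<Rightarrow> complex) \<Rightarrow> 'b \<Rightarrow> complex)
      \<Rightarrow> ('a \<times> 'b \<Rightarrow> complex) \<Rightarrow> 'a \<times> 'b \<Rightarrow> complex" where
  "tensor_op S T F = (\<lambda>(x, y). S (\<lambda>x'. T (\<lambda>y'. F (x', y')) y) x)"

definition A_op ::
    "nat \<Rightarrow> complex \<Rightarrow> (nat \<Rightarrow> (nat \<Rightarrow> real) \<Rightarrow> complex)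
      \<Rightarrow> (nat \<Rightarrow> real) \<times> (nat \<Rightarrow> real) \<Rightarrow> (nat \<Rightarrow> real) \<times> (nat \<Rightarrow> real) \<Rightarrow> complex" where
  "A_op n z h = (\<lambda>(\<tau>, \<sigma>) p.
     \<Sum>j=1..n. \<Sum>k=1..n.
       complex_of_real (\<tau> j) powr ((z - 1) / 2) * complex_of_real (\<sigma> k) powr ((z - 1) / 2) *
       tensor_op (P_op n j \<tau>) (P_op n k \<sigma>) (J_op n (h j)) p)"

lemma walsh_coeff_walsh:
  assumes "A \<subseteq> {1..n}" "B \<subseteq> {1..n}"
  shows "walsh_coeff n (walsh A) B = (if A = B then 1 else 0)"
proof -
  define g :: "nat \<Rightarrow> real \<Rightarrow> complex"
    where "g i t = (if i \<in> A then of_real t else 1) * (if i \<in> B then of_real t else 1)" for i t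
  have fin: "finite (cube n)"
    unfolding cube_def by (intro finite_PiE) auto
  have walsh_eq: "walsh C x = (\<Prod>i\<in>{1..n}. if i \<in> C then complex_of_real (x i) else 1)"
    if "C \<subseteq> {1..n}" for C x
    using that by (simp add: walsh_def prod.If_cases Int_absorb1)
  have card_cube: "card (cube n) = 2 ^ n"
    by (simp add: cube_def card_PiE numeral_2_eq_2)
  have "walsh_coeff n (walsh A) B = (\<Sum>x\<in>cube n. walsh A x * walsh B x) / card (cube n)"
    unfolding walsh_coeff_def cube_measure_def
    using fin by (simp add: uniform_count_measure_def lebesgue_integral_point_measure_finite
        scaleR_conv_of_real sum_divide_distrib)
  also have "(\<Sum>x\<in>cube n. walsh A x * walsh B x) = (\<Sum>x\<in>cube n. \<Prod>i\<in>{1..n}. g i (x i))"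
    by (simp only: walsh_eq[OF assms(1)] walsh_eq[OF assms(2)] g_def prod.distrib)
  also have "\<dots> = (\<Prod>i\<in>{1..n}. \<Sum>t\<in>{-1, 1}. g i t)"
    unfolding cube_def by (intro prod_sum_PiE[symmetric]) auto
  also have "\<dots> = (\<Prod>i\<in>{1..n}. if i \<in> A \<longleftrightarrow> i \<in> B then 2 else 0)"
    by (intro prod.cong) (auto simp: g_def)
  also have "\<dots> = (if A = B then 2 ^ n else 0)"
    using assms by (auto simp: prod_zero_iff)
  finally show ?thesis
    by (simp add: card_cube)
qed

lemma P_op_walsh:
  assumes "A \<subseteq> {1..n}"
  shows "P_op n j \<tau> (walsh A) x = indicator A j * indicator (V_set n A j) \<tau> * walsh A x"
proof -
  have "P_op n j \<tau> (walsh A) x =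
      (\<Sum>B\<in>Pow {1..n}. if B = A then indicator A j * indicator (V_set n A j) \<tau> * walsh A x else 0)"
    unfolding P_op_def by (intro sum.cong) (use assms in \<open>auto simp: walsh_coeff_walsh\<close>)
  also have "\<dots> = indicator A j * indicator (V_set n A j) \<tau> * walsh A x"
    using assms by simp
  finally show ?thesis .
qed

end

theory Submission
  imports Defs
begin

text \<open>
  Everything is diagonal in the Walsh basis, so the identity can be checked one set \<open>A\<close> at a time.
  Because \<open>walsh A\<close> is a character of the cube, \<open>J_op n f\<close> is the sum of
  \<open>walsh_coeff n f A * walsh A x * walsh A y\<close>, and applying \<open>P_op n j \<tau>\<close> in \<open>x\<close> and
  \<open>P_op n k \<sigma>\<close> in \<open>y\<close> retains the term of \<open>A\<close> exactly when \<open>j, k \<in> A\<close>,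
  \<open>\<tau> \<in> V_set n A j\<close> and \<open>\<sigma> \<in> V_set n A k\<close> (\<open>tensor_P_op_J_op\<close>).

  Integrating this term against the powers of \<open>\<tau> j\<close> and \<open>\<sigma> k\<close> gives a product of two integrals
  of the same kind. With \<open>w = (z + 1) / 2\<close>, each is the expectation of \<open>(\<tau> j) powr (w - 1)\<close> on the
  event that \<open>\<tau> j\<close> is minimal among the coordinates in \<open>A\<close>. Given \<open>\<tau> j = t\<close>, this event has
  probability \<open>exp (- (card A - 1) t)\<close>, and a Gamma integral yields
  \<open>Gamma w * card A powr (- w)\<close>, whatever \<open>j \<in> A\<close> is (\<open>integral_powr_V_set\<close>).

  Summing over \<open>k \<in> A\<close> contributes a factor \<open>card A\<close>, so the total power of \<open>card A\<close> is
  \<open>1 - 2 w = - z\<close>, the multiplier of the Laplacian in \<open>B_op\<close>. Summing over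
  \<open>j \<in> A\<close> gives the sum of the coefficients of the \<open>h j\<close>, and this is the Walsh
  coefficient of the sum of the discrete derivatives, since \<open>discrete_deriv j\<close> is the projection
  onto the Walsh functions of the sets containing \<open>j\<close> (\<open>J_op_B_op\<close>).
\<close>

section \<open>Walsh expansions of the operators\<close>

lemma finite_cube: "finite (cube n)"
  unfolding cube_def by (intro finite_PiE) auto

lemma card_cube: "card (cube n) = 2 ^ n"
  by (simp add: cube_def card_PiE numeral_2_eq_2)

lemma walsh_coeff_eq_sum:
  "walsh_coeff n f A = (\<Sum>x\<in>cube n. f x * walsh A x) / 2 ^ n"
  unfolding walsh_coeff_def cube_measure_def
  using finite_cube[of n]
  by (simp add: uniform_count_measure_def lebesgue_integral_point_measure_finite
      scaleR_conv_of_real sum_divide_distrib card_cube)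

lemma walsh_coeff_cong:
  assumes "\<And>x. x \<in> cube n \<Longrightarrow> f x = g x"
  shows "walsh_coeff n f A = walsh_coeff n g A"
  using assms by (simp add: walsh_coeff_eq_sum)

lemma walsh_coeff_cmult: "walsh_coeff n (\<lambda>x. c * f x) A = c * walsh_coeff n f A"
  by (simp add: walsh_coeff_eq_sum sum_distrib_left mult.assoc)

lemma walsh_coeff_sum:
  "walsh_coeff n (\<lambda>x. \<Sum>i\<in>I. f i x) A = (\<Sum>i\<in>I. walsh_coeff n (f i) A)"
  unfolding walsh_coeff_eq_sum sum_divide_distrib[symmetric] sum_distrib_right
  by (subst sum.swap) simp

definition cube_mult :: "nat \<Rightarrow> (nat \<Rightarrow> real) \<Rightarrow> (nat \<Rightarrow> real) \<Rightarrow> nat \<Rightarrow> real" where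
  "cube_mult n x y = (\<lambda>i\<in>{1..n}. x i * y i)"

lemma cube_mult_in_cube:
  assumes "x \<in> cube n" "y \<in> cube n"
  shows "cube_mult n x y \<in> cube n"
proof -
  have "x i * y i \<in> {-1, 1}" if "i \<in> {1..n}" for i
  proof -
    have "x i \<in> {-1, 1}" "y i \<in> {-1, 1}"
      using assms that unfolding cube_def by (blast dest: PiE_mem)+
    then show ?thesis by auto
  qed
  then show ?thesis
    unfolding cube_def cube_mult_def by (intro restrict_PiE_iff[THEN iffD2]) blast
qed

lemma cube_mult_cancel:
  assumes "x \<in> cube n" "y \<in> cube n"
  shows "cube_mult n x (cube_mult n x y) = y"
proof
  fix i
  show "cube_mult n x (cube_mult n x y) i = y i"
  proof (cases "i \<in> {1..n}")
    case True
    then have "x i \<in> {-1, 1}"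
      using assms unfolding cube_def by (blast dest: PiE_mem)
    then show ?thesis using True by (auto simp: cube_mult_def)
  next
    case False
    then show ?thesis
      using assms unfolding cube_def cube_mult_def by (auto simp: PiE_def extensional_def)
  qed
qed

lemma walsh_cube_mult:
  assumes "A \<subseteq> {1..n}"
  shows "walsh A (cube_mult n x y) = walsh A x * walsh A y"
proof -
  have "walsh A (cube_mult n x y) = (\<Prod>i\<in>A. complex_of_real (x i) * complex_of_real (y i))"
    unfolding walsh_def cube_mult_def using assms by (intro prod.cong) auto
  then show ?thesis
    by (simp add: walsh_def prod.distrib)
qed

lemma J_op_eq: "J_op n f (x, y) = f (cube_mult n x y)"
  by (simp add: J_op_def cube_mult_def)

text \<open>
  The cube is a group under coordinatewise multiplication, the Walsh functions are its characters,
  and the measure is translation invariant; so a translation multiplies each Walsh coefficient by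
  the value of the character.
\<close>

lemma walsh_coeff_cube_mult:
  assumes "x \<in> cube n" "A \<subseteq> {1..n}"
  shows "walsh_coeff n (\<lambda>y. f (cube_mult n x y)) A = walsh_coeff n f A * walsh A x"
proof -
  have "(\<Sum>y\<in>cube n. f (cube_mult n x y) * walsh A y) =
        (\<Sum>u\<in>cube n. f u * walsh A (cube_mult n x u))"
    by (rule sum.reindex_bij_witness[where i = "cube_mult n x" and j = "cube_mult n x"])
       (simp_all add: cube_mult_in_cube cube_mult_cancel assms)
  also have "\<dots> = (\<Sum>u\<in>cube n. f u * walsh A u) * walsh A x"
    by (simp add: walsh_cube_mult[OF assms(2)] sum_distrib_right sum_distrib_left mult_ac)
  finally show ?thesis
    by (simp add: walsh_coeff_eq_sum)
qed

lemma flip_flip: "flip j (flip j x) = x"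
  by (simp add: flip_def)

lemma walsh_flip:
  assumes "finite A"
  shows "walsh A (flip j x) = (if j \<in> A then - walsh A x else walsh A x)"
proof -
  have "walsh A (flip j x) = (\<Prod>i\<in>A. (if i = j then - 1 else 1) * complex_of_real (x i))"
    unfolding walsh_def flip_def by (intro prod.cong) auto
  also have "\<dots> = (\<Prod>i\<in>A. if i = j then - 1 else 1) * walsh A x"
    by (simp only: prod.distrib walsh_def)
  finally show ?thesis
    using assms by (simp add: prod.delta)
qed

lemma flip_in_cube:
  assumes "x \<in> cube n" "j \<in> {1..n}"
  shows "flip j x \<in> cube n"
proof -
  have "x j \<in> {-1, 1}"
    using assms unfolding cube_def by (blast dest: PiE_mem)
  then show ?thesis
    using assms by (auto simp: cube_def flip_def PiE_iff extensional_def)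
qed

text \<open>
  Reversing the sign of a coordinate preserves the measure, so the difference can be moved onto the
  Walsh function, which changes sign if \<open>j \<in> A\<close> and is otherwise unchanged.
\<close>

lemma walsh_coeff_discrete_deriv:
  assumes "j \<in> {1..n}" "A \<subseteq> {1..n}"
  shows "walsh_coeff n (discrete_deriv j f) A = indicator A j * walsh_coeff n f A"
proof -
  have fin: "finite A" using assms(2) finite_subset by blast
  have "(\<Sum>x\<in>cube n. f (flip j x) * walsh A x) = (\<Sum>x\<in>cube n. f x * walsh A (flip j x))"
    by (rule sum.reindex_bij_witness[where i = "flip j" and j = "flip j"])
       (use assms in \<open>simp_all add: flip_in_cube flip_flip\<close>)
  then have "(\<Sum>x\<in>cube n. discrete_deriv j f x * walsh A x) =
     (\<Sum>x\<in>cube n. f x * ((walsh A x - walsh A (flip j x)) / 2))"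
    by (simp add: discrete_deriv_def left_diff_distrib right_diff_distrib diff_divide_distrib
        sum_subtractf flip: sum_divide_distrib)
  also have "\<dots> = indicator A j * (\<Sum>x\<in>cube n. f x * walsh A x)"
    using fin by (cases "j \<in> A") (simp_all add: walsh_flip)
  finally show ?thesis
    by (simp add: walsh_coeff_eq_sum)
qed

text \<open>
  Since Walsh functions are multiplicative, \<open>J_op n f\<close> is a combination of the products
  \<open>walsh A x * walsh A y\<close> only, with no mixed terms for two different sets. Both projections are
  diagonal on Walsh functions, so their tensor product keeps this single sum over \<open>A\<close>.
\<close>

lemma tensor_P_op_J_op:
  assumes "x \<in> cube n" "y \<in> cube n"
  shows "tensor_op (P_op n j \<tau>) (P_op n k \<sigma>) (J_op n f) (x, y) =
    (\<Sum>A\<in>Pow {1..n}. indicator A j * indicator (V_set n A j) \<tau> *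
       (indicator A k * indicator (V_set n A k) \<sigma>) * (walsh_coeff n f A * walsh A (cube_mult n x y)))"
proof -
  define c where "c A = indicator A k * indicator (V_set n A k) \<sigma> * walsh_coeff n f A * walsh A y" for A
  \<comment> \<open>The points of the first variable must be kept in the cube: only there is translation by
      \<open>x'\<close> measure preserving. The outer Walsh coefficient sees no other points.\<close>
  have inner: "P_op n k \<sigma> (\<lambda>y'. J_op n f (x', y')) y = (\<Sum>A\<in>Pow {1..n}. c A * walsh A x')"
    if "x' \<in> cube n" for x'
    unfolding P_op_def J_op_eq c_def
    using that by (intro sum.cong) (auto simp: walsh_coeff_cube_mult)
  have coeff: "walsh_coeff n (\<lambda>x'. P_op n k \<sigma> (\<lambda>y'. J_op n f (x', y')) y) A = c A"
    if "A \<subseteq> {1..n}" for A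
  proof -
    have "walsh_coeff n (\<lambda>x'. P_op n k \<sigma> (\<lambda>y'. J_op n f (x', y')) y) A =
          walsh_coeff n (\<lambda>x'. \<Sum>B\<in>Pow {1..n}. c B * walsh B x') A"
      by (rule walsh_coeff_cong) (rule inner)
    also have "\<dots> = (\<Sum>B\<in>Pow {1..n}. c B * walsh_coeff n (walsh B) A)"
      by (simp only: walsh_coeff_sum walsh_coeff_cmult)
    also have "\<dots> = (\<Sum>B\<in>Pow {1..n}. if B = A then c A else 0)"
      using that by (intro sum.cong) (auto simp: walsh_coeff_walsh)
    also have "\<dots> = c A"
      using that by simp
    finally show ?thesis .
  qed
  show ?thesis
    unfolding tensor_op_def case_prod_conv P_op_def[of n j]
    by (intro sum.cong refl) (simp add: coeff c_def walsh_cube_mult)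
qed

lemma J_op_B_op:
  "J_op n (B_op n z h) (x, y) =
     (\<Sum>A | A \<noteq> {} \<and> A \<subseteq> {1..n}. of_nat (card A) powr (- z) *
        (\<Sum>j\<in>A. walsh_coeff n (h j) A) * walsh A (cube_mult n x y))"
proof -
  have "walsh_coeff n (\<lambda>x. \<Sum>j=1..n. discrete_deriv j (h j) x) A = (\<Sum>j\<in>A. walsh_coeff n (h j) A)"
    if "A \<subseteq> {1..n}" for A
  proof -
    have "walsh_coeff n (\<lambda>x. \<Sum>j=1..n. discrete_deriv j (h j) x) A =
       (\<Sum>j=1..n. indicator A j * walsh_coeff n (h j) A)"
      using that by (simp add: walsh_coeff_sum walsh_coeff_discrete_deriv)
    also have "\<dots> = (\<Sum>j\<in>A. walsh_coeff n (h j) A)"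
      using that by (intro sum.mono_neutral_cong_right) auto
    finally show ?thesis .
  qed
  then show ?thesis
    unfolding J_op_eq B_op_def laplace_pow_def by (intro sum.cong) auto
qed

section \<open>Moments of exponential variables\<close>

lemma space_exp_measure: "space exp_measure = {0<..}"
  by (simp add: exp_measure_def space_restrict_space)

lemma measurable_exp_measure:
  "f \<in> borel_measurable borel \<Longrightarrow> f \<in> borel_measurable exp_measure"
  by (simp add: exp_measure_def measurable_restrict_space1)

text \<open>
  On the positive half-line the complex power is \<open>exp (w * ln t)\<close> with the real logarithm, so the
  branch cut does not interfere.
\<close>

lemma measurable_powr_exp_measure:
  fixes w :: complex
  shows "(\<lambda>t. complex_of_real t powr w) \<in> borel_measurable exp_measure"
proof -
  have "(\<lambda>t. exp (w * complex_of_real (ln t))) \<in> borel_measurable exp_measure"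
    by (rule measurable_exp_measure) measurable
  moreover have "exp (w * complex_of_real (ln t)) = complex_of_real t powr w"
    if "t \<in> space exp_measure" for t
    using that by (simp add: space_exp_measure powr_def Ln_of_real)
  ultimately show ?thesis
    by (simp cong: measurable_cong)
qed

lemma has_bochner_integral_exp_measure_iff:
  fixes f :: "real \<Rightarrow> 'a :: {banach, second_countable_topology}"
  assumes "f \<in> borel_measurable exp_measure"
  shows "has_bochner_integral exp_measure f c \<longleftrightarrow>
     has_bochner_integral lborel (\<lambda>t. indicator {0<..} t *\<^sub>R exp (- t) *\<^sub>R f t) c"
proof -
  have "f \<in> borel_measurable (restrict_space lborel {0<..})"
    using assms by (simp add: exp_measure_def)
  moreover have "(\<lambda>t. exp (- t)) \<in> borel_measurable (restrict_space lborel {0::real<..})"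
    by (intro measurable_restrict_space1) measurable
  ultimately show ?thesis
    unfolding has_bochner_integral_iff exp_measure_def
    by (simp add: integrable_density integral_density integrable_restrict_space integral_restrict_space)
qed

lemma emeasure_exp_measure_atLeast:
  assumes "0 \<le> t"
  shows "emeasure exp_measure ({t..} \<inter> {0<..}) = ennreal (exp (- t))"
proof -
  have *: "(\<lambda>t. exp (- t)) \<in> borel_measurable (restrict_space lborel {0::real<..})"
    by (intro measurable_restrict_space1) measurable
  have "emeasure exp_measure ({t..} \<inter> {0<..}) =
     (\<integral>\<^sup>+x. ennreal (exp (- x)) * indicator ({t..} \<inter> {0<..}) x \<partial>restrict_space lborel {0<..})"
    unfolding exp_measure_def using *
    by (intro emeasure_density) (auto simp: sets_restrict_space)
  also have "\<dots> = (\<integral>\<^sup>+x. ennreal (exp (- x)) * indicator {t..} x \<partial>lborel)"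
  proof -
    have "AE x in lborel. x \<noteq> (0::real)"
      by (rule AE_lborel_singleton)
    then show ?thesis
      using assms by (subst nn_integral_restrict_space)
        (auto intro!: nn_integral_cong_AE simp: indicator_def elim!: eventually_mono)
  qed
  also have "\<dots> = ennreal (0 - (- exp (- t)))"
  proof (rule nn_integral_FTC_atLeast)
    show "((\<lambda>x. - exp (- x)) \<longlongrightarrow> (0::real)) at_top"
      using tendsto_minus[OF filterlim_compose[OF exp_at_bot filterlim_uminus_at_bot_at_top]] by simp
  qed (auto intro!: derivative_eq_intros)
  finally show ?thesis by simp
qed

lemma prob_space_exp_measure: "prob_space exp_measure"
  by (rule prob_spaceI) (use emeasure_exp_measure_atLeast[of 0] in \<open>simp add: space_exp_measure Int_absorb1 subset_eq\<close>)

lemma Gamma_integral_lborel: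
  assumes "Re w > 0"
  shows "has_bochner_integral lborel
     (\<lambda>t. indicator {0<..} t *\<^sub>R (complex_of_real t powr (w - 1) / of_real (exp t))) (Gamma w)"
proof -
  let ?f = "\<lambda>t. complex_of_real t powr (w - 1) / of_real (exp t)"
  let ?g = "\<lambda>t. indicator {0<..} t *\<^sub>R ?f t"
  have abs: "?f absolutely_integrable_on {0<..}"
    by (rule absolutely_integrable_Gamma_integral'[OF assms])
  have int: "integral {0<..} ?f = Gamma w"
    using Gamma_integral_complex'[OF assms] by (rule integral_unique)
  have "(\<lambda>t. indicator {0<..} t *\<^sub>R (exp ((w - 1) * complex_of_real (ln t)) / of_real (exp t)))
     \<in> borel_measurable lborel" by measurable
  also have "(\<lambda>t. indicator {0<..} t *\<^sub>R (exp ((w - 1) * complex_of_real (ln t)) / of_real (exp t))) = ?g"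
    by (auto simp: fun_eq_iff indicator_def powr_def Ln_of_real)
  finally have meas: "?g \<in> borel_measurable lborel" .
  show ?thesis
    using abs set_lebesgue_integral_eq_integral(2)[OF abs] int meas
    by (simp add: has_bochner_integral_iff set_integrable_def set_lebesgue_integral_def
        integrable_completion integral_completion)
qed

text \<open>
  Rescaling \<open>t\<close> by the total exponential rate \<open>1 + b\<close>, of which \<open>1\<close> is the density of the measure,
  reduces this to the Gamma integral.
\<close>

lemma Gamma_integral_exp_measure:
  assumes "Re w > 0" "b > - 1"
  shows "has_bochner_integral exp_measure
     (\<lambda>t. complex_of_real t powr (w - 1) * of_real (exp (- (b * t)))) (Gamma w * of_real (1 + b) powr (- w))"
proof -
  define c where "c = 1 + b"
  have c: "c > 0" using assms by (simp add: c_def)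
  let ?g = "\<lambda>t. indicator {0<..} t *\<^sub>R (complex_of_real t powr (w - 1) / of_real (exp t))"
  have "has_bochner_integral lborel (\<lambda>x. ?g (0 + c * x)) (Gamma w /\<^sub>R \<bar>c\<bar>)"
    using Gamma_integral_lborel[OF assms(1)] c
    by (subst lborel_has_bochner_integral_real_affine_iff[symmetric]) auto
  then have "has_bochner_integral lborel (\<lambda>x. ?g (0 + c * x) / of_real c powr (w - 1))
        (Gamma w /\<^sub>R \<bar>c\<bar> / of_real c powr (w - 1))"
    by (rule has_bochner_integral_divide_zero)
  also have "(\<lambda>x. ?g (0 + c * x) / of_real c powr (w - 1)) =
     (\<lambda>t. indicator {0<..} t *\<^sub>R exp (- t) *\<^sub>R (complex_of_real t powr (w - 1) * of_real (exp (- (b * t)))))"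
  proof
    fix t
    have "complex_of_real (c * t) powr (w - 1) = of_real c powr (w - 1) * of_real t powr (w - 1)" if "t > 0"
      using that c by (simp add: powr_times_real)
    moreover have "of_real (exp (- t)) * of_real (exp (- (b * t))) = (1 / of_real (exp (c * t)) :: complex)"
      by (simp add: c_def algebra_simps exp_add exp_minus field_simps)
    ultimately show "?g (0 + c * t) / of_real c powr (w - 1) =
       indicator {0<..} t *\<^sub>R exp (- t) *\<^sub>R (complex_of_real t powr (w - 1) * of_real (exp (- (b * t))))"
      using c by (simp add: indicator_def zero_less_mult_iff scaleR_conv_of_real mult_ac)
         (simp add: mult.assoc[symmetric])
  qed
  also have "Gamma w /\<^sub>R \<bar>c\<bar> / of_real c powr (w - 1) = Gamma w * of_real c powr (- w)"
    using c by (simp add: powr_diff powr_minus scaleR_conv_of_real field_simps)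
  finally have "has_bochner_integral exp_measure
     (\<lambda>t. complex_of_real t powr (w - 1) * of_real (exp (- (b * t)))) (Gamma w * of_real c powr (- w))"
    by (subst has_bochner_integral_exp_measure_iff)
       (intro borel_measurable_times measurable_powr_exp_measure measurable_exp_measure; measurable)
  then show ?thesis unfolding c_def .
qed

lemma has_bochner_integral_indicator_atLeast_exp_measure:
  assumes "0 \<le> t"
  shows "has_bochner_integral exp_measure (indicator {t..}) (complex_of_real (exp (- t)))"
proof -
  interpret E: prob_space exp_measure by (rule prob_space_exp_measure)
  let ?S = "{t..} \<inter> {0<..}"
  have sets: "?S \<in> sets exp_measure"
    by (auto simp: exp_measure_def sets_restrict_space)
  have "has_bochner_integral exp_measure (\<lambda>x. indicator ?S x *\<^sub>R (1::complex)) (measure exp_measure ?S *\<^sub>R 1)"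
    by (intro has_bochner_integral_scaleR_left has_bochner_integral_real_indicator sets E.emeasure_finite[THEN less_top[THEN iffD1, rotated]]) (simp add: E.emeasure_eq_measure)
  moreover have "measure exp_measure ?S = exp (- t)"
    using emeasure_exp_measure_atLeast[OF assms] by (simp add: measure_def)
  ultimately show ?thesis
    by (subst has_bochner_integral_cong[OF refl _ refl, where g = "\<lambda>x. indicator ?S x *\<^sub>R (1::complex)"])
       (auto simp: space_exp_measure indicator_def scaleR_conv_of_real)
qed

text \<open>
  With the coordinate \<open>j\<close> held at \<open>t\<close>, membership in \<open>V_set n A j\<close> says that each of the other
  \<open>card A - 1\<close> coordinates in \<open>A\<close> is at least \<open>t\<close>. These are independent events of
  probability \<open>exp (- t)\<close>.
\<close>

lemma integral_V_set_slice:
  assumes "A \<subseteq> {1..n}" "j \<in> A" "t > 0"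
  shows "(\<integral>X. indicator (V_set n A j) (X(j := t)) \<partial>Pi\<^sub>M ({1..n} - {j}) (\<lambda>_. exp_measure)) =
    complex_of_real (exp (- (real (card A - 1) * t)))"
proof -
  interpret E: prob_space exp_measure by (rule prob_space_exp_measure)
  define I where "I = {1..n} - {j}"
  have I: "insert j I = {1..n}" "finite I" and fin: "finite A"
    using assms finite_subset by (auto simp: I_def)
  interpret P: product_prob_space "\<lambda>_. exp_measure" I ..
  have tail: "integrable exp_measure (indicator {t..} :: real \<Rightarrow> complex)"
       "(\<integral>s. indicator {t..} s \<partial>exp_measure) = complex_of_real (exp (- t))"
    using has_bochner_integral_indicator_atLeast_exp_measure[of t] assms(3)
    by (auto simp: has_bochner_integral_iff)
  have "(\<integral>X. indicator (V_set n A j) (X(j := t)) \<partial>Pi\<^sub>M I (\<lambda>_. exp_measure)) =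
        (\<integral>X. (\<Prod>i\<in>I. if i \<in> A then indicator {t..} (X i) else 1 :: complex) \<partial>Pi\<^sub>M I (\<lambda>_. exp_measure))"
  proof (rule Bochner_Integration.integral_cong[OF refl])
    fix X assume "X \<in> space (Pi\<^sub>M I (\<lambda>_. exp_measure))"
    then have X: "X \<in> I \<rightarrow>\<^sub>E {0<..}" by (simp add: space_PiM space_exp_measure)
    then have "X(j := t) \<in> {1..n} \<rightarrow>\<^sub>E {0<..}"
      using assms(3) unfolding I(1)[symmetric] by (auto simp: PiE_iff extensional_def)
    then have "X(j := t) \<in> V_set n A j \<longleftrightarrow> (\<forall>i\<in>A. (X(j := t)) i \<ge> t)"
      by (simp add: V_set_def)
    also have "\<dots> \<longleftrightarrow> (\<forall>i\<in>I. i \<in> A \<longrightarrow> X i \<ge> t)"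
      using assms by (auto simp: I_def)
    finally show "indicator (V_set n A j) (X(j := t)) =
        (\<Prod>i\<in>I. if i \<in> A then indicator {t..} (X i) else 1 :: complex)"
      using I(2) by (cases "\<forall>i\<in>I. i \<in> A \<longrightarrow> t \<le> X i")
        (auto simp: prod_zero_iff indicator_def intro: prod.neutral)
  qed
  also have "\<dots> = (\<Prod>i\<in>I. \<integral>s. (if i \<in> A then indicator {t..} s else 1) \<partial>exp_measure)"
  proof (rule P.product_integral_prod[OF I(2)])
    show "integrable exp_measure (\<lambda>s. if i \<in> A then indicator {t..} s else 1 :: complex)" for i
      using tail(1) by (cases "i \<in> A") simp_all
  qed
  also have "\<dots> = (\<Prod>i\<in>I. if i \<in> A then of_real (exp (- t)) else 1)"
    using tail(2) by (intro prod.cong) (auto simp: E.prob_space)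
  also have "\<dots> = of_real (exp (- t)) ^ card (A - {j})"
  proof -
    have "I \<inter> A = A - {j}" using assms by (auto simp: I_def)
    then show ?thesis using I(2) by (simp add: prod.If_cases)
  qed
  also have "\<dots> = of_real (exp (- (real (card A - 1) * t)))"
    using assms(2) fin by (simp flip: of_real_power exp_of_nat_mult)
  finally show ?thesis unfolding I_def .
qed

text \<open>
  Conditioning on \<open>\<tau> j = t\<close> replaces the indicator of \<open>V_set n A j\<close> by the exponential factor
  \<open>exp (- (card A - 1) t)\<close>, which merges with the density \<open>exp (- t)\<close> into \<open>exp (- card A t)\<close>.
  The Gamma integral at that rate produces the power of \<open>card A\<close>: this is how the sets \<open>V_set\<close>
  encode a negative power of the Laplacian.
\<close>

lemma integral_powr_V_set:
  assumes "Re w > 0" "A \<subseteq> {1..n}" "j \<in> A"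
  shows "has_bochner_integral (exp_measure_pow n)
    (\<lambda>\<tau>. complex_of_real (\<tau> j) powr (w - 1) * indicator (V_set n A j) \<tau>)
    (Gamma w * of_nat (card A) powr (- w))"
proof -
  interpret E: prob_space exp_measure by (rule prob_space_exp_measure)
  define I where "I = {1..n} - {j}"
  have I: "insert j I = {1..n}" "j \<notin> I" "finite I"
    using assms by (auto simp: I_def)
  interpret P: product_prob_space "\<lambda>_. exp_measure" I ..
  interpret pair: pair_sigma_finite exp_measure "Pi\<^sub>M I (\<lambda>_. exp_measure)" ..
  let ?F = "\<lambda>\<tau>. complex_of_real (\<tau> j) powr (w - 1) * indicator (V_set n A j) \<tau>"
  have j: "j \<in> {1..n}" using assms by auto
  have comp: "(\<lambda>\<tau>. \<tau> i) \<in> borel_measurable (exp_measure_pow n)" if "i \<in> {1..n}" for i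
    unfolding exp_measure_pow_def
    by (rule measurable_compose[OF measurable_component_singleton[OF that] measurable_exp_measure]) simp
  have space: "space (exp_measure_pow n) = {1..n} \<rightarrow>\<^sub>E {0<..}"
    by (simp add: exp_measure_pow_def space_PiM space_exp_measure)
  have V_eq: "V_set n A j = {\<tau> \<in> space (exp_measure_pow n). \<forall>i\<in>A. \<tau> j \<le> \<tau> i}"
    by (simp add: V_set_def space)
  have fin: "finite A" using assms finite_subset by blast
  have V_meas: "V_set n A j \<in> sets (exp_measure_pow n)"
    unfolding V_eq using comp assms fin
    by (intro sets.sets_Collect_finite_All borel_measurable_le) auto
  \<comment> \<open>The power depends on one coordinate only and the indicator is bounded, so integrability
      reduces to that of the one-dimensional Gamma integrand.\<close>
  have int_powr: "integrable (exp_measure_pow n) (\<lambda>\<tau>. complex_of_real (\<tau> j) powr (w - 1))"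
  proof -
    have "integrable (distr (exp_measure_pow n) exp_measure (\<lambda>\<tau>. \<tau> j)) (\<lambda>t. complex_of_real t powr (w - 1))"
      unfolding exp_measure_pow_def using Gamma_integral_exp_measure[OF assms(1), of 0] j
      by (subst distr_PiM_component) (auto simp: has_bochner_integral_iff E.prob_space_axioms)
    then show ?thesis
      by (subst (asm) integrable_distr_eq)
         (auto simp: exp_measure_pow_def measurable_powr_exp_measure intro!: measurable_component_singleton j[simplified])
  qed
  have int: "integrable (exp_measure_pow n) ?F"
    using integrable_mult_indicator[OF V_meas int_powr] by (simp add: scaleR_conv_of_real mult.commute of_real_indicator)
  have upd_meas: "(\<lambda>(t, X). X(j := t)) \<in> exp_measure \<Otimes>\<^sub>M Pi\<^sub>M I (\<lambda>_. exp_measure) \<rightarrow>\<^sub>M exp_measure_pow n"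
    unfolding exp_measure_pow_def I(1)[symmetric] by measurable
  have distr: "exp_measure_pow n = distr (exp_measure \<Otimes>\<^sub>M Pi\<^sub>M I (\<lambda>_. exp_measure)) (exp_measure_pow n) (\<lambda>(t, X). X(j := t))"
    using distr_pair_PiM_eq_PiM[of I "\<lambda>_. exp_measure" j] I(1)
    by (simp add: exp_measure_pow_def E.prob_space_axioms)
  have int2: "integrable (exp_measure \<Otimes>\<^sub>M Pi\<^sub>M I (\<lambda>_. exp_measure)) (\<lambda>(t, X). ?F (X(j := t)))"
    using integrable_distr[OF upd_meas, of ?F] distr int by (simp add: case_prod_beta')
  have "(\<integral>\<tau>. ?F \<tau> \<partial>exp_measure_pow n) = (\<integral>p. ?F (case p of (t, X) \<Rightarrow> X(j := t)) \<partial>(exp_measure \<Otimes>\<^sub>M Pi\<^sub>M I (\<lambda>_. exp_measure)))"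
    using int by (subst distr, intro integral_distr upd_meas) (auto intro: borel_measurable_integrable)
  also have "\<dots> = (\<integral>t. \<integral>X. ?F (X(j := t)) \<partial>Pi\<^sub>M I (\<lambda>_. exp_measure) \<partial>exp_measure)"
    using pair.integral_fst'[OF int2] by (simp add: case_prod_beta')
  also have "\<dots> = (\<integral>t. complex_of_real t powr (w - 1) * of_real (exp (- (real (card A - 1) * t))) \<partial>exp_measure)"
  proof (rule Bochner_Integration.integral_cong[OF refl])
    fix t assume "t \<in> space exp_measure"
    then have t: "t > 0" by (simp add: space_exp_measure)
    have "(\<integral>X. ?F (X(j := t)) \<partial>Pi\<^sub>M I (\<lambda>_. exp_measure)) =
        complex_of_real t powr (w - 1) * (\<integral>X. indicator (V_set n A j) (X(j := t)) \<partial>Pi\<^sub>M I (\<lambda>_. exp_measure))"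
      by simp
    also have "(\<integral>X. indicator (V_set n A j) (X(j := t)) \<partial>Pi\<^sub>M I (\<lambda>_. exp_measure)) =
        complex_of_real (exp (- (real (card A - 1) * t)))"
      unfolding I_def by (rule integral_V_set_slice[OF assms(2,3) t])
    finally show "(\<integral>X. ?F (X(j := t)) \<partial>Pi\<^sub>M I (\<lambda>_. exp_measure)) =
      complex_of_real t powr (w - 1) * of_real (exp (- (real (card A - 1) * t)))" .
  qed
  also have "\<dots> = Gamma w * of_nat (card A) powr (- w)"
  proof -
    have "card A > 0" using assms fin card_gt_0_iff by blast
    then have "complex_of_real (1 + real (card A - 1)) = of_nat (card A)"
      by (simp add: of_nat_diff)
    then show ?thesis
      using Gamma_integral_exp_measure[OF assms(1), of "real (card A - 1)"]
      by (simp add: has_bochner_integral_iff)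
  qed
  finally show ?thesis
    using int by (simp add: has_bochner_integral_iff)
qed

lemma has_bochner_integral_pair_mult:
  fixes f :: "'a \<Rightarrow> 'c :: {real_normed_field, banach, second_countable_topology}"
  assumes "sigma_finite_measure M" "sigma_finite_measure N"
    and f: "has_bochner_integral M f a" and g: "has_bochner_integral N g b"
  shows "has_bochner_integral (M \<Otimes>\<^sub>M N) (\<lambda>(x, y). f x * g y) (a * b)"
proof -
  interpret M: sigma_finite_measure M by fact
  interpret N: sigma_finite_measure N by fact
  interpret pair_sigma_finite M N ..
  have f': "integrable M f" "integral\<^sup>L M f = a" and g': "integrable N g" "integral\<^sup>L N g = b"
    using f g by (auto simp: has_bochner_integral_iff)
  have [measurable]: "f \<in> borel_measurable M" "g \<in> borel_measurable N" using f' g' by auto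
  have int: "integrable (M \<Otimes>\<^sub>M N) (\<lambda>(x, y). f x * g y)"
    using f' g' by (intro Fubini_integrable) (auto simp: norm_mult)
  then show ?thesis
    using integral_fst'[OF int] f' g' by (simp add: has_bochner_integral_iff)
qed

section \<open>The integral of the randomized operator\<close>

theorem proposition3p3:
  fixes n :: nat and z :: complex
    and h :: "nat \<Rightarrow> (nat \<Rightarrow> real) \<Rightarrow> complex"
    and x y :: "nat \<Rightarrow> real"
  assumes "1 / 2 \<le> Re z" and "Re z \<le> 1"
    and "x \<in> cube n" and "y \<in> cube n"
  shows "integrable (exp_measure_pow n \<Otimes>\<^sub>M exp_measure_pow n)
           (\<lambda>(\<tau>, \<sigma>). A_op n z h (\<tau>, \<sigma>) (x, y)) \<and>
         (LINT (\<tau>, \<sigma>)|(exp_measure_pow n \<Otimes>\<^sub>M exp_measure_pow n). A_op n z h (\<tau>, \<sigma>) (x, y))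
           = Gamma ((z + 1) / 2) ^ 2 * J_op n (B_op n z h) (x, y)"
proof -
  define w where "w = (z + 1) / 2"
  have w: "Re w > 0" "w - 1 = (z - 1) / 2"
    using assms(1) by (auto simp: w_def field_simps)
  let ?N = "exp_measure_pow n"
  let ?c = "\<lambda>j A. walsh_coeff n (h j) A * walsh A (cube_mult n x y)"
  define F where "F A j = (\<lambda>\<tau>. complex_of_real (\<tau> j) powr (w - 1) * indicator (V_set n A j) \<tau>)" for A j
  define G where "G A = Gamma w * of_nat (card A) powr (- w)" for A :: "nat set"
  interpret E: prob_space exp_measure by (rule prob_space_exp_measure)
  interpret P: product_prob_space "\<lambda>_. exp_measure" "{1..n}" ..
  have sigma_finite: "sigma_finite_measure ?N"
    unfolding exp_measure_pow_def by (rule P.sigma_finite_measure_axioms)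
  \<comment> \<open>If \<open>j\<close> or \<open>k\<close> is not in \<open>A\<close>, both sides vanish; otherwise \<open>\<tau>\<close> and \<open>\<sigma>\<close> separate.\<close>
  have summand: "has_bochner_integral (?N \<Otimes>\<^sub>M ?N)
      (\<lambda>p. indicator A j * indicator A k * ?c j A * (case p of (\<tau>, \<sigma>) \<Rightarrow> F A j \<tau> * F A k \<sigma>))
      (indicator A j * indicator A k * ?c j A * (G A * G A))"
    if A: "A \<in> Pow {1..n}" for A j k
  proof (cases "j \<in> A \<and> k \<in> A")
    case True
    then show ?thesis
      unfolding F_def G_def using A w(1)
      by (intro has_bochner_integral_mult_right has_bochner_integral_pair_mult sigma_finite integral_powr_V_set) auto
  qed auto
  have A_op_eq: "A_op n z h (\<tau>, \<sigma>) (x, y) = (\<Sum>j=1..n. \<Sum>k=1..n. \<Sum>A\<in>Pow {1..n}.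
      indicator A j * indicator A k * ?c j A * (F A j \<tau> * F A k \<sigma>))" for \<tau> \<sigma>
    unfolding A_op_def case_prod_conv tensor_P_op_J_op[OF assms(3,4)] sum_distrib_left F_def w(2)
    by (intro sum.cong refl) (simp add: mult_ac)
  have integral: "has_bochner_integral (?N \<Otimes>\<^sub>M ?N) (\<lambda>(\<tau>, \<sigma>). A_op n z h (\<tau>, \<sigma>) (x, y))
      (\<Sum>j=1..n. \<Sum>k=1..n. \<Sum>A\<in>Pow {1..n}. indicator A j * indicator A k * ?c j A * (G A * G A))"
  proof -
    have "has_bochner_integral (?N \<Otimes>\<^sub>M ?N)
      (\<lambda>p. \<Sum>j=1..n. \<Sum>k=1..n. \<Sum>A\<in>Pow {1..n}.
        indicator A j * indicator A k * ?c j A * (case p of (\<tau>, \<sigma>) \<Rightarrow> F A j \<tau> * F A k \<sigma>))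
      (\<Sum>j=1..n. \<Sum>k=1..n. \<Sum>A\<in>Pow {1..n}. indicator A j * indicator A k * ?c j A * (G A * G A))"
      by (intro has_bochner_integral_sum summand)
    then show ?thesis
      by (simp add: A_op_eq case_prod_beta')
  qed
  \<comment> \<open>Since \<open>G A\<close> does not depend on \<open>k\<close>, the sum over \<open>k \<in> A\<close> counts the elements of \<open>A\<close>.\<close>
  have "(\<Sum>j=1..n. \<Sum>k=1..n. \<Sum>A\<in>Pow {1..n}. indicator A j * indicator A k * ?c j A * (G A * G A))
      = (\<Sum>A\<in>Pow {1..n}. of_nat (card A) * (G A * G A) * (\<Sum>j\<in>A. ?c j A))"
  proof -
    have "(\<Sum>j=1..n. \<Sum>k=1..n. \<Sum>A\<in>Pow {1..n}. indicator A j * indicator A k * ?c j A * (G A * G A))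
        = (\<Sum>A\<in>Pow {1..n}. \<Sum>j=1..n. \<Sum>k=1..n. indicator A j * indicator A k * ?c j A * (G A * G A))"
      by (simp only: sum.swap[of _ "Pow {1..n}"])
    also have "\<dots> = (\<Sum>A\<in>Pow {1..n}. of_nat (card A) * (G A * G A) * (\<Sum>j\<in>A. ?c j A))"
    proof (intro sum.cong refl)
      fix A assume "A \<in> Pow {1..n}"
      then have A: "A \<subseteq> {1..n}" by simp
      have "(\<Sum>j=1..n. \<Sum>k=1..n. indicator A j * indicator A k * ?c j A * (G A * G A))
          = (\<Sum>k=1..n. indicator A k) * (G A * G A) * (\<Sum>j=1..n. indicator A j * ?c j A)"
        unfolding sum_distrib_left sum_distrib_right by (intro sum.cong refl) (simp add: mult_ac)
      also have "(\<Sum>k=1..n. indicator A k) = (of_nat (card A) :: complex)"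
      proof -
        have "(\<Sum>k=1..n. indicator A k) = (\<Sum>k\<in>A. 1 :: complex)"
          using A by (intro sum.mono_neutral_cong_right) auto
        then show ?thesis by simp
      qed
      also have "(\<Sum>j=1..n. indicator A j * ?c j A) = (\<Sum>j\<in>A. ?c j A)"
        using A by (intro sum.mono_neutral_cong_right) auto
      finally show "(\<Sum>j=1..n. \<Sum>k=1..n. indicator A j * indicator A k * ?c j A * (G A * G A))
          = of_nat (card A) * (G A * G A) * (\<Sum>j\<in>A. ?c j A)" .
    qed
    finally show ?thesis .
  qed
  also have "\<dots> = (\<Sum>A | A \<noteq> {} \<and> A \<subseteq> {1..n}. Gamma w ^ 2 * (of_nat (card A) powr (- z) *
        (\<Sum>j\<in>A. walsh_coeff n (h j) A) * walsh A (cube_mult n x y)))"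
  proof (rule sum.mono_neutral_cong_right)
    fix A assume "A \<in> {A. A \<noteq> {} \<and> A \<subseteq> {1..n}}"
    then have "card A \<noteq> 0" by (auto dest: finite_subset)
    then have "of_nat (card A) * (G A * G A) = Gamma w ^ 2 * of_nat (card A) powr (1 + - w + - w)"
      by (simp only: powr_add) (simp add: G_def power2_eq_square)
    also have "1 + - w + - w = - z"
      by (simp add: w_def field_simps)
    finally show "of_nat (card A) * (G A * G A) * (\<Sum>j\<in>A. ?c j A) =
        Gamma w ^ 2 * (of_nat (card A) powr (- z) * (\<Sum>j\<in>A. walsh_coeff n (h j) A) * walsh A (cube_mult n x y))"
      by (simp add: sum_distrib_right mult.assoc)
  qed auto
  also have "\<dots> = Gamma w ^ 2 * J_op n (B_op n z h) (x, y)"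
    by (simp only: J_op_B_op sum_distrib_left)
  finally show ?thesis
    using integral by (simp add: has_bochner_integral_iff w_def)
qed

end
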